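(* Let $q$ be a prime power, $m\geq 2$, $k\geq 2$, and let $h<k$ be a positive integer with $m\geq h+1$. If $U$ is an $h$-scattered $\mathbb{F}_q$-subspace of $\mathbb{F}_{q^m}^k$ of $\mathbb{F}_q$-dimension at least $\left\lfloor\frac{m(k-1)}{h+1}\right\rfloor+1$, then $U$ is a rank $\rho$-saturating system for some $\rho\leq h+1$.
   Context: An $\mathbb{F}_q$-subspace $U$ of $V=\mathbb{F}_{q^m}^k$ is $h$-scattered ($h<k$ a positive integer) if $\langle U\rangle_{\mathbb{F}_{q^m}}=V$ and every $\mathbb{F}_{q^m}$-subspace $W$ of $V$ of $\mathbb{F}_{q^m}$-dimension $h$ satisfies $\dim_{\mathbb{F}_q}(W\cap U)\leq h$. For an $\mathbb{F}_q$-subspace $U$ of $V$, $L_U=\{\langle u\rangle_{\mathbb{F}_{q^m}} : u\in U\setminus\{0\}\}\subseteq \mathrm{PG}(k-1,q^m)$. For $\mathcal S\subseteq \mathrm{PG}(k-1,q^m)$, a point $Q$ is $(\rho-1)$-saturated by $\mathcal S$ if there are $\rho$ points $P_1,\dots,P_\rho\in\mathcal S$ with $Q\in\langle P_1,\dots,P_\rho\rangle_{\mathbb{F}_{q^m}}$; $\mathcal S$ is a $(\rho-1)$-saturating set if every point of $\mathrm{PG}(k-1,q^m)$ is $(\rho-1)$-saturated by $\mathcal S$ and $\rho$ is the smallest value with this property. $U$ is a rank $\rho$-saturating system if $L_U$ is a $(\rho-1)$-saturating set. *)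

theory Defs
  imports "HOL-Analysis.Cartesian_Space"
begin

text \<open>
  The extension of the field with \<open>q\<close> elements by the field with \<open>q ^ m\<close> elements is given by
  two finite field types \<open>'f\<close> and \<open>'e\<close> and an embedding of \<open>'f\<close> into \<open>'e\<close>; the cardinalities
  are fixed in the theorem. The index type \<open>'n\<close> has \<open>k\<close> elements, so that \<open>'e ^ 'n\<close> is the
  \<open>k\<close>-dimensional coordinate space over \<open>'e\<close>. Linear algebra over \<open>'e\<close> is that of the
  interpretation \<open>vec\<close>.
\<close>

definition field_embedding :: "('f::field \<Rightarrow> 'e::field) \<Rightarrow> bool" where
  "field_embedding \<iota> \<longleftrightarrow>
     \<iota> 1 = 1 \<and> (\<forall>x y. \<iota> (x + y) = \<iota> x + \<iota> y) \<and> (\<forall>x y. \<iota> (x * y) = \<iota> x * \<iota> y)"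

definition small_scale ::
  "('f::field \<Rightarrow> 'e::field) \<Rightarrow> 'f \<Rightarrow> 'e ^ 'n \<Rightarrow> 'e ^ 'n::finite" where
  "small_scale \<iota> c v = \<iota> c *s v"

lemma vector_space_small_scale:
  assumes "field_embedding \<iota>"
  shows "vector_space (small_scale \<iota>)"
  using assms by unfold_locales
    (auto simp: field_embedding_def small_scale_def vec_eq_iff algebra_simps)

abbreviation small_subspace ::
  "('f::field \<Rightarrow> 'e::field) \<Rightarrow> ('e ^ 'n::finite) set \<Rightarrow> bool" where
  "small_subspace \<iota> \<equiv> module.subspace (small_scale \<iota>)"

abbreviation small_dim ::
  "('f::field \<Rightarrow> 'e::field) \<Rightarrow> ('e ^ 'n::finite) set \<Rightarrow> nat" where
  "small_dim \<iota> \<equiv> vector_space.dim (small_scale \<iota>)"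

definition scattered ::
  "('f::field \<Rightarrow> 'e::field) \<Rightarrow> nat \<Rightarrow> ('e ^ 'n::finite) set \<Rightarrow> bool" where
  "scattered \<iota> h U \<longleftrightarrow>
     small_subspace \<iota> U \<and> vec.span U = UNIV \<and>
     (\<forall>W. vec.subspace W \<and> vec.dim W = h \<longrightarrow> small_dim \<iota> (W \<inter> U) \<le> h)"

definition proj_points :: "('e::field ^ 'n::finite) set set" where
  "proj_points = {P. vec.subspace P \<and> vec.dim P = 1}"

definition linear_set :: "('e::field ^ 'n::finite) set \<Rightarrow> ('e ^ 'n) set set" where
  "linear_set U = {vec.span {u} | u. u \<in> U - {0}}"

text \<open>
  The parameter \<open>\<rho>\<close> below is the number of points used, so \<open>saturates \<rho>\<close> is
  \<open>(\<rho> - 1)\<close>-saturation. The points of the list \<open>Ps\<close> need not be distinct; this does not affect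
  the least \<open>\<rho>\<close> for which all points are saturated, since it is at most the rank of the span
  of \<open>S\<close>.
\<close>

definition saturates ::
  "nat \<Rightarrow> ('e::field ^ 'n::finite) set set \<Rightarrow> ('e ^ 'n) set \<Rightarrow> bool" where
  "saturates \<rho> S Q \<longleftrightarrow>
     (\<exists>Ps. length Ps = \<rho> \<and> set Ps \<subseteq> S \<and> Q \<subseteq> vec.span (\<Union>(set Ps)))"

definition saturating_set :: "nat \<Rightarrow> ('e::field ^ 'n::finite) set set \<Rightarrow> bool" where
  "saturating_set \<rho> S \<longleftrightarrow>
     S \<subseteq> proj_points \<and> (\<forall>Q\<in>proj_points. saturates \<rho> S Q) \<and>
     (\<forall>\<rho>'<\<rho>. \<not> (\<forall>Q\<in>proj_points. saturates \<rho>' S Q))"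

definition saturating_system ::
  "('f::field \<Rightarrow> 'e::field) \<Rightarrow> nat \<Rightarrow> ('e ^ 'n::finite) set \<Rightarrow> bool" where
  "saturating_system \<iota> \<rho> U \<longleftrightarrow> small_subspace \<iota> U \<and> saturating_set \<rho> (linear_set U)"

end

theory Submission imports Defs begin

text \<open>
  Fix \<open>v \<noteq> 0\<close> and a set \<open>T\<close> of \<open>h + 1\<close> elements of the large field that are independent over the
  small one; it exists because \<open>m \<ge> h + 1\<close>. The additive map
  \<open>(u, l) \<mapsto> (\<Sum>t\<in>T. t u(t)) - l v\<close> from \<open>U ^ T \<times> 'e\<close> to \<open>'e ^ 'n\<close> cannot be injective, since
  \<open>dim U (h + 1) + m > m (k - 1) + m = m k\<close>. Its kernel therefore contains some \<open>(u, l) \<noteq> 0\<close>.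
  Here \<open>l \<noteq> 0\<close>: as \<open>U\<close> is \<open>h\<close>-scattered, at most \<open>h + 1\<close> vectors of \<open>U\<close> that are independent over
  the small field stay independent over the large one, so \<open>\<Sum>t\<in>T. t u(t) = 0\<close> forces \<open>u = 0\<close>. Hence
  \<open>v\<close> lies in the span of the \<open>h + 1\<close> vectors \<open>u(t)\<close>.
\<close>

section \<open>Cardinality and dimension\<close>

lemma (in vector_space) card_span_independent:
  assumes "independent B" "finite B"
  shows "card (span B) = CARD('a) ^ card B"
proof -
  let ?f = "\<lambda>c. \<Sum>b\<in>B. scale (c b) b"
  \<comment> \<open>Coefficient families are taken extensional on \<open>B\<close>: there are
    \<open>CARD('a) ^ card B\<close> of them, and two that agree on \<open>B\<close> are
    equal.\<close>
  have "inj_on ?f (B \<rightarrow>\<^sub>E UNIV)"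
  proof (rule inj_onI)
    fix c d assume c: "c \<in> B \<rightarrow>\<^sub>E UNIV" and d: "d \<in> B \<rightarrow>\<^sub>E UNIV" and eq: "?f c = ?f d"
    have "(\<Sum>b\<in>B. scale (c b - d b) b) = 0"
      using eq by (simp add: scale_left_diff_distrib sum_subtractf)
    then have "c b = d b" if "b \<in> B" for b
      using independentD[OF assms(1,2) order_refl, of "\<lambda>b. c b - d b" b] that by simp
    then show "c = d" by (rule PiE_ext[OF c d])
  qed
  moreover have "?f ` (B \<rightarrow>\<^sub>E UNIV) = span B"
  proof -
    have "?f c \<in> ?f ` (B \<rightarrow>\<^sub>E UNIV)" for c
      by (rule image_eqI[of _ _ "restrict c B"]) auto
    then show ?thesis unfolding span_finite[OF assms(2)] by blast
  qed
  ultimately have "card (span B) = card (B \<rightarrow>\<^sub>E (UNIV :: 'a set))"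
    using card_image by fastforce
  then show ?thesis using assms(2) by (simp add: card_PiE)
qed

lemma (in vector_space) card_subspace:
  assumes "subspace S" "finite S"
  shows "card S = CARD('a) ^ dim S"
proof -
  obtain B where B: "B \<subseteq> S" "independent B" "S \<subseteq> span B" "card B = dim S"
    using basis_exists by blast
  then have "span B = S" using span_subspace[OF _ _ assms(1)] by blast
  then show ?thesis
    using card_span_independent[of B] B assms(2) by (metis finite_subset)
qed

lemma vector_space_embedding:
  assumes "field_embedding \<iota>"
  shows "vector_space (\<lambda>c x. \<iota> c * x)"
  using assms by unfold_locales (auto simp: field_embedding_def algebra_simps)

text \<open>Counting shows that \<open>'e\<close> has dimension \<open>m\<close> over the small
  field; any \<open>r\<close> members of a basis will do.\<close>

lemma obtain_independent_scalars:
  fixes \<iota> :: "'f::{field,finite} \<Rightarrow> 'e::{field,finite}"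
  assumes "field_embedding \<iota>" "CARD('e) = CARD('f) ^ m" "r \<le> m"
  obtains T where "card T = r" "\<not> module.dependent (\<lambda>c x. \<iota> c * x) T"
proof -
  interpret E: vector_space "\<lambda>c x. \<iota> c * x"
    by (rule vector_space_embedding[OF assms(1)])
  have "CARD('f) > 1" using card_mono[of UNIV "{0, 1 :: 'f}"] by simp
  then have "E.dim UNIV = m"
    using E.card_subspace[of UNIV] assms(2) by simp
  then obtain B where B: "E.independent B" "card B = m"
    using E.basis_exists by metis
  obtain T where "T \<subseteq> B" "card T = r"
    using obtain_subset_with_card_n[of r B] assms(3) B(2) by blast
  then show ?thesis using that E.independent_mono[OF B(1)] by blast
qed

section \<open>Independence over the large field\<close>

text \<open>Extend a basis of \<open>S\<close> to one of the whole space and keep \<open>d\<close>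
  of its vectors. Scatteredness constrains only subspaces of dimension exactly \<open>h\<close>, so
  smaller spans have to be enlarged.\<close>

lemma vec_exists_subspace_dim:
  fixes S :: "('e::field ^ 'n::finite) set"
  assumes "vec.dim S \<le> d" "d \<le> CARD('n)"
  obtains W where "vec.subspace W" "S \<subseteq> W" "vec.dim W = d"
proof -
  obtain B where B: "B \<subseteq> S" "vec.independent B" "S \<subseteq> vec.span B" "card B = vec.dim S"
    using vec.basis_exists by blast
  obtain C where C: "B \<subseteq> C" "vec.independent C" "UNIV \<subseteq> vec.span C"
    using vec.maximal_independent_subset_extend[of B UNIV] B(2) by auto
  then have "card C = CARD('n)"
    using vec.dim_eq_card[of C UNIV] vec.dim_UNIV by (simp add: card_cart_basis top.extremum_uniqueI)
  moreover have "finite C" using C(2) by (rule vec.finiteI_independent)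
  ultimately obtain D where D: "B \<subseteq> D" "D \<subseteq> C" "card D = d"
    using exists_subset_between[of B d C] B(4) C(1) assms by auto
  then have "vec.independent D" using vec.independent_mono[OF C(2)] by blast
  then have "vec.dim (vec.span D) = d"
    using D(3) by (simp add: vec.dim_eq_card_independent)
  moreover have "S \<subseteq> vec.span D" using B(3) vec.span_mono[OF D(1)] by blast
  ultimately show ?thesis using that vec.subspace_span by blast
qed

text \<open>If \<open>B\<close> has exactly \<open>h + 1\<close> vectors and is dependent, it lies
  in a subspace of dimension \<open>h\<close>, which then meets \<open>U\<close> in small dimension
  above \<open>h\<close>. A smaller \<open>B\<close> gives no such contradiction, so it is first
  enlarged inside \<open>U\<close>, one vector at a time.\<close>

lemma scattered_independent:
  fixes \<iota> :: "'f::field \<Rightarrow> 'e::field" and U :: "('e ^ 'n::finite) set"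
  assumes emb: "field_embedding \<iota>" and sc: "scattered \<iota> h U" and h: "h < CARD('n)"
    and U: "finite U"
    and B: "B \<subseteq> U" "\<not> module.dependent (small_scale \<iota>) B" "card B \<le> h + 1"
  shows "vec.independent B"
  using B
proof (induction "h + 1 - card B" arbitrary: B)
  interpret S: vector_space "small_scale \<iota>" by (rule vector_space_small_scale[OF emb])
  {
    case 0
    \<comment> \<open>The vanishing difference and the bound on \<open>card B\<close> give
      \<open>card B = h + 1\<close>.\<close>
    show ?case
    proof
      assume dep: "vec.dependent B"
      have finB: "finite B" using U 0 finite_subset by blast
      obtain b where b: "b \<in> B" "b \<in> vec.span (B - {b})"
        using dep by (auto simp: vec.dependent_def)
      then have "B \<subseteq> vec.span (B - {b})"
        using vec.span_superset[of "B - {b}"] by auto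
      then have "vec.dim B \<le> card (B - {b})" using finB by (intro vec.dim_le_card) auto
      also have "\<dots> \<le> h" using 0 b finB by simp
      finally obtain W where W: "vec.subspace W" "B \<subseteq> W" "vec.dim W = h"
        using vec_exists_subspace_dim[of B h] h by auto
      have "S.dim (W \<inter> U) \<le> h" using sc W unfolding scattered_def by blast
      moreover have "card B \<le> S.dim (W \<inter> U)"
      proof -
        obtain C where C: "C \<subseteq> W \<inter> U" "S.independent C" "W \<inter> U \<subseteq> S.span C"
            "card C = S.dim (W \<inter> U)"
          using S.basis_exists by blast
        have "finite C" using C(1) U finite_subset by blast
        then show ?thesis
          using S.independent_span_bound[of C B] C W(2) 0 by fastforce
      qed
      ultimately show False using 0 by linarith
    qed
  next
    case (Suc n)
    have finB: "finite B" using U Suc.prems finite_subset by blast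
    have "vec.dim B < CARD('n)"
      using vec.dim_le_card'[OF finB] Suc.hyps(2) h by linarith
    \<comment> \<open>\<open>U\<close> spans the whole space, whereas \<open>B\<close> has at most
      \<open>h < CARD('n)\<close> vectors.\<close>
    have "\<not> U \<subseteq> vec.span B"
    proof
      assume "U \<subseteq> vec.span B"
      then have "UNIV \<subseteq> vec.span B"
        using sc vec.span_minimal[of U "vec.span B"] by (simp add: scattered_def)
      then have "vec.dim (UNIV :: ('e ^ 'n) set) \<le> vec.dim B" by (rule vec.dim_mono)
      then show False
        using \<open>vec.dim B < CARD('n)\<close> vec.dim_UNIV by (simp add: card_cart_basis)
    qed
    then obtain u where u: "u \<in> U" "u \<notin> vec.span B" by blast
    \<comment> \<open>Since \<open>u\<close> avoids the large span it also avoids the small one, so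
      adding it keeps \<open>B\<close> independent over the small field.\<close>
    have "S.span B \<subseteq> vec.span B"
      by (rule S.span_minimal)
        (auto simp: S.subspace_def small_scale_def vec.span_superset vec.span_zero
          intro: vec.span_add vec.span_scale)
    then have "S.independent (insert u B)"
      using u Suc.prems S.independent_insertI by blast
    moreover have "u \<notin> B" using u(2) vec.span_base by blast
    ultimately have "vec.independent (insert u B)"
      using Suc.hyps u(1) Suc.prems finB by (intro Suc.hyps(1)) auto
    then show ?case using vec.independent_mono by blast
  }
qed

text \<open>Expand every \<open>u t\<close> in a basis \<open>B\<close> chosen among these vectors
  over the small field. Having at most \<open>h + 1\<close> members, \<open>B\<close> is independent
  over the large field too, so the total coefficient of each \<open>b\<close> vanishes. That
  coefficient is a small-field combination of \<open>T\<close>, whose independence makes every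
  \<open>c t b\<close> zero.\<close>

lemma scattered_combination_eq_0:
  fixes \<iota> :: "'f::field \<Rightarrow> 'e::field" and U :: "('e ^ 'n::finite) set"
  assumes emb: "field_embedding \<iota>" and sc: "scattered \<iota> h U" and h: "h < CARD('n)"
    and U: "finite U"
    and T: "finite T" "card T \<le> h + 1" "\<not> module.dependent (\<lambda>c x. \<iota> c * x) T"
    and u: "\<And>t. t \<in> T \<Longrightarrow> u t \<in> U" and eq: "(\<Sum>t\<in>T. t *s u t) = 0" and t: "t \<in> T"
  shows "u t = 0"
proof -
  interpret S: vector_space "small_scale \<iota>" by (rule vector_space_small_scale[OF emb])
  interpret E: vector_space "\<lambda>c x. \<iota> c * x" by (rule vector_space_embedding[OF emb])
  obtain B where B: "B \<subseteq> u ` T" "S.independent B" "u ` T \<subseteq> S.span B"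
    using S.basis_exists by blast
  have finB: "finite B" using B(1) T(1) finite_surj by blast
  have "card B \<le> h + 1" using B(1) T(1,2) surj_card_le[of T B u] by linarith
  then have ind: "vec.independent B"
    using B u by (intro scattered_independent[OF emb sc h U]) auto
  have "\<forall>t\<in>T. \<exists>c. u t = (\<Sum>b\<in>B. small_scale \<iota> (c b) b)"
    using B(3) unfolding S.span_finite[OF finB] by blast
  then obtain c where c: "u t = (\<Sum>b\<in>B. small_scale \<iota> (c t b) b)" if "t \<in> T" for t
    by metis
  have "(\<Sum>b\<in>B. (\<Sum>t\<in>T. \<iota> (c t b) * t) *s b) = (\<Sum>b\<in>B. \<Sum>t\<in>T. (\<iota> (c t b) * t) *s b)"
    by (simp add: vec.scale_sum_left)
  also have "\<dots> = (\<Sum>t\<in>T. \<Sum>b\<in>B. (\<iota> (c t b) * t) *s b)"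
    by (rule sum.swap)
  also have "\<dots> = (\<Sum>t\<in>T. t *s u t)"
    by (intro sum.cong) (simp_all add: c vec.scale_sum_right small_scale_def mult.commute)
  finally have "(\<Sum>t\<in>T. \<iota> (c t b) * t) = 0" if "b \<in> B" for b
    using vec.independentD[OF ind finB order_refl _ that, of "\<lambda>b. \<Sum>t\<in>T. \<iota> (c t b) * t"] eq
    by simp
  then have "c t b = 0" if "b \<in> B" for b
    using E.independentD[OF T(3,1) order_refl _ t, of "\<lambda>t. c t b"] that by simp
  then show ?thesis using c[OF t] by simp
qed

section \<open>The counting argument\<close>

lemma scattered_mem_span:
  fixes \<iota> :: "'f::{field,finite} \<Rightarrow> 'e::{field,finite}"
    and U :: "('e ^ 'n::finite) set"
  assumes emb: "field_embedding \<iota>" and sc: "scattered \<iota> h U" and h: "h < CARD('n)"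
    and m: "CARD('e) = CARD('f) ^ m"
    and dim: "small_dim \<iota> U * (h + 1) > m * (CARD('n) - 1)"
    and T: "card T = h + 1" "\<not> module.dependent (\<lambda>c x. \<iota> c * x) T"
  obtains u where "\<And>t. t \<in> T \<Longrightarrow> u t \<in> U" "v \<in> vec.span (u ` T)"
proof (cases "v = 0")
  case True
  interpret S: vector_space "small_scale \<iota>" by (rule vector_space_small_scale[OF emb])
  have "0 \<in> U" using sc S.subspace_0 unfolding scattered_def by blast
  then show ?thesis using that[of "\<lambda>_. 0"] True vec.span_zero by auto
next
  case False
  interpret S: vector_space "small_scale \<iota>" by (rule vector_space_small_scale[OF emb])
  have subU: "S.subspace U" using sc by (simp add: scattered_def)
  have finT: "finite T" by simp
  let ?D = "(T \<rightarrow>\<^sub>E U) \<times> (UNIV :: 'e set)"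
  let ?f = "\<lambda>(u, l). (\<Sum>t\<in>T. t *s u t) - l *s v"
  have q: "CARD('f) > 1" using card_mono[of UNIV "{0, 1 :: 'f}"] by simp
  \<comment> \<open>Both cardinalities are powers of \<open>CARD('f)\<close>; \<open>dim\<close> is
    the strict inequality between the exponents once \<open>m\<close> is added to both
    sides.\<close>
  have "CARD('e ^ 'n) = CARD('f) ^ (m * CARD('n))" by (simp add: m power_mult)
  also have "m * CARD('n) = m * (CARD('n) - 1) + m"
    using h by (cases "CARD('n)") auto
  also have "CARD('f) ^ (m * (CARD('n) - 1) + m) < CARD('f) ^ (S.dim U * (h + 1) + m)"
    using q dim by (intro power_strict_increasing) auto
  also have "\<dots> = card ?D"
    using S.card_subspace[OF subU] T(1)
    by (simp add: card_PiE card_cartesian_product m power_add power_mult)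
  finally have "CARD('e ^ 'n) < card ?D" .
  then have "\<not> inj_on ?f ?D"
    using card_inj_on_le[of ?f ?D UNIV] by auto
  then obtain u1 l1 u2 l2 where u: "u1 \<in> T \<rightarrow>\<^sub>E U" "u2 \<in> T \<rightarrow>\<^sub>E U" "(u1, l1) \<noteq> (u2, l2)"
      and eq: "(\<Sum>t\<in>T. t *s u1 t) - l1 *s v = (\<Sum>t\<in>T. t *s u2 t) - l2 *s v"
    unfolding inj_on_def by auto
  \<comment> \<open>The difference \<open>(w, l1 - l2)\<close> of the two colliding pairs is the
    kernel element.\<close>
  define w where "w t = u1 t - u2 t" for t
  have w: "w t \<in> U" if "t \<in> T" for t
    using u that S.subspace_diff[OF subU] by (auto simp: w_def)
  have weq: "(\<Sum>t\<in>T. t *s w t) = (l1 - l2) *s v"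
    using eq by (simp add: w_def vec.scale_right_diff_distrib vec.scale_left_diff_distrib
        sum_subtractf algebra_simps)
  have "l1 \<noteq> l2"
  proof
    assume "l1 = l2"
    then have "w t = 0" if "t \<in> T" for t
      using scattered_combination_eq_0[OF emb sc h _ finT _ T(2) w _ that] weq T(1) by simp
    then have "u1 = u2" using u by (intro PiE_ext[OF u(1,2)]) (simp add: w_def)
    then show False using u(3) \<open>l1 = l2\<close> by simp
  qed
  then have "v = inverse (l1 - l2) *s (\<Sum>t\<in>T. t *s w t)"
    unfolding weq by (simp add: vec.scale_scale)
  also have "\<dots> \<in> vec.span (w ` T)"
    by (intro vec.span_scale vec.span_sum vec.span_base) auto
  finally show ?thesis using that w by blast
qed

section \<open>From vectors to points\<close>

text \<open>\<open>saturates\<close> asks for a list of exactly \<open>r\<close> points, so each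
  \<open>t\<close> contributes one, possibly repeated.\<close>

lemma saturates_linear_set:
  fixes U :: "('e::field ^ 'n::finite) set"
  assumes T: "finite T" "card T = r" and u: "\<And>t. t \<in> T \<Longrightarrow> u t \<in> U"
    and v: "v \<noteq> 0" "v \<in> vec.span (u ` T)"
  shows "saturates r (linear_set U) (vec.span {v})"
proof -
  obtain s where s: "s \<in> T" "u s \<noteq> 0"
  proof (rule ccontr)
    assume "\<not> thesis"
    then have "u ` T \<subseteq> {0}" using that by blast
    then show False using v vec.span_mono[of "u ` T" "{0}"] by auto
  qed
  \<comment> \<open>Vanishing \<open>u t\<close> define no point; any point can stand in for them.\<close>
  define w where "w t = (if u t = 0 then u s else u t)" for t
  obtain ts where ts: "set ts = T" "length ts = r"
    using finite_distinct_list[OF T(1)] T(2) distinct_card by metis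
  let ?Ps = "map (\<lambda>t. vec.span {w t}) ts"
  have "set ?Ps \<subseteq> linear_set U"
    using s u unfolding linear_set_def w_def set_map ts by fastforce
  moreover have "u t \<in> vec.span (\<Union>(set ?Ps))" if "t \<in> T" for t
  proof (cases "u t = 0")
    case False
    then have "u t \<in> vec.span {w t}" by (simp add: w_def vec.span_base)
    then show ?thesis using that ts by (intro vec.span_base) auto
  qed (simp add: vec.span_zero)
  then have "vec.span (u ` T) \<subseteq> vec.span (\<Union>(set ?Ps))"
    by (intro vec.span_minimal vec.subspace_span) auto
  then have "vec.span {v} \<subseteq> vec.span (\<Union>(set ?Ps))"
    using v(2) by (intro vec.span_minimal vec.subspace_span) auto
  ultimately show ?thesis unfolding saturates_def using ts by (metis length_map)
qed

lemma proj_pointsE: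
  assumes "Q \<in> proj_points"
  obtains v where "v \<noteq> 0" "Q = vec.span {v}"
proof -
  have Q: "vec.subspace Q" "vec.dim Q = 1" using assms by (auto simp: proj_points_def)
  obtain B where B: "B \<subseteq> Q" "vec.independent B" "Q \<subseteq> vec.span B" "card B = 1"
    using vec.basis_exists[of Q] Q(2) by metis
  then obtain v where v: "B = {v}" using card_1_singletonE by metis
  then have "v \<noteq> 0" using B(2) vec.dependent_zero by blast
  moreover have "Q = vec.span {v}" using vec.span_subspace[OF B(1,3) Q(1)] v by simp
  ultimately show ?thesis using that by blast
qed

lemma linear_set_subset_proj_points: "linear_set U \<subseteq> proj_points"
proof
  fix P assume "P \<in> linear_set U"
  then obtain u where "u \<noteq> 0" "P = vec.span {u}" by (auto simp: linear_set_def)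
  then show "P \<in> proj_points"
    using vec.dim_eq_card_independent[of "{u}"]
    by (simp add: proj_points_def vec.independent_insert)
qed

theorem theorem2p7:
  fixes \<iota> :: "'f::{field,finite} \<Rightarrow> 'e::{field,finite}"
    and U :: "('e ^ 'n::finite) set"
    and q m k h :: nat
  assumes "field_embedding \<iota>"
    and "CARD('f) = q" and "CARD('e) = q ^ m" and "CARD('n) = k"
    and "m \<ge> 2" and "k \<ge> 2"
    and "0 < h" and "h < k" and "m \<ge> h + 1"
    and "scattered \<iota> h U"
    and "small_dim \<iota> U \<ge> m * (k - 1) div (h + 1) + 1"
  shows "\<exists>\<rho>\<le>h + 1. saturating_system \<iota> \<rho> U"
proof -
  let ?sat = "\<lambda>r. \<forall>Q\<in>proj_points. saturates r (linear_set U) Q"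
  \<comment> \<open>The \<open>+ 1\<close> after the floor is what makes the inequality
    strict.\<close>
  have "m * (k - 1) < (m * (k - 1) div (h + 1) + 1) * (h + 1)"
    using dividend_less_div_times[of "h + 1" "m * (k - 1)"] by simp
  also have "\<dots> \<le> small_dim \<iota> U * (h + 1)"
    using assms(11) by (rule mult_le_mono1)
  finally have dim: "m * (CARD('n) - 1) < small_dim \<iota> U * (h + 1)"
    using assms(4) by simp
  have card: "CARD('e) = CARD('f) ^ m" and h: "h < CARD('n)" using assms by auto
  obtain T where T: "card T = h + 1" "\<not> module.dependent (\<lambda>c x. \<iota> c * x) T"
    using obtain_independent_scalars[OF assms(1) card assms(9)] by blast
  have sat: "?sat (h + 1)"
  proof
    fix Q :: "('e ^ 'n) set" assume "Q \<in> proj_points"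
    then obtain v where v: "v \<noteq> 0" "Q = vec.span {v}" by (rule proj_pointsE)
    obtain u where "\<And>t. t \<in> T \<Longrightarrow> u t \<in> U" "v \<in> vec.span (u ` T)"
      using scattered_mem_span[OF assms(1,10) h card dim T] by blast
    then show "saturates (h + 1) (linear_set U) Q"
      unfolding v(2) using T(1) v(1) by (intro saturates_linear_set[of T]) auto
  qed
  \<comment> \<open>\<open>saturating_set\<close> demands minimality, so the witness is the least
    sufficient number of points, which may be below \<open>h + 1\<close>.\<close>
  define r where "r = (LEAST r. ?sat r)"
  have "r \<le> h + 1" unfolding r_def using sat by (rule Least_le)
  moreover have "?sat r" unfolding r_def using sat by (rule LeastI)
  moreover have "\<not> ?sat r'" if "r' < r" for r'
    using that unfolding r_def by (rule not_less_Least)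
  ultimately have "saturating_system \<iota> r U"
    using assms(10) linear_set_subset_proj_points
    by (auto simp: saturating_system_def saturating_set_def scattered_def)
  then show ?thesis using \<open>r \<le> h + 1\<close> by blast
qed

end
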